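(* Let $n \ge 7$ be an integer. In the hypercube $Q_n$ there exist three completely independent spanning trees such that two of these trees have diameters at most $2n+1$ and $2n+3$ respectively, and the third tree has diameter at most $2n+4$.
   Context: The $n$-dimensional hypercube $Q_n$ is the graph whose vertices are the binary strings of length $n$, two strings being adjacent iff they differ in exactly one coordinate. For a tree $T$ and vertices $u,v$ of $T$, let $P_T(u,v)$ denote the set of vertices on the unique $u$–$v$ path in $T$. Spanning trees $T_1,\dots,T_m$ of a graph $G$ are called completely independent spanning trees (CISTs) if they are pairwise edge-disjoint and, for every pair of distinct trees $T_i,T_j$ and every pair of vertices $u,v\in V(G)$, $P_{T_i}(u,v)\cap P_{T_j}(u,v)=\{u,v\}$. The diameter of a tree is the maximum distance in the tree between two of its vertices. *)

theory Defs
  imports "Graph_Theory.Graph_Theory"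
begin

text \<open>
  Undirected graphs are symmetric digraphs without loops: an undirected edge \<open>{x, y}\<close> is the
  pair of arcs \<open>(x, y)\<close>, \<open>(y, x)\<close>.
\<close>

definition hypercube :: "nat \<Rightarrow> bool list pair_pre_digraph" where
  "hypercube n =
    \<lparr> pverts = {x. length x = n},
      parcs = {(x, y). length x = n \<and> length y = n \<and> (\<exists>!i. i < n \<and> x ! i \<noteq> y ! i)} \<rparr>"

text \<open>
  The library predicate \<^const>\<open>tree\<close> is not the undirected notion: it only excludes directed
  cycles, and it counts the two arcs of a single undirected edge as a cycle. In a symmetric
  digraph, the cycles of the underlying undirected simple graph are exactly the directed cycles
  of length at least 3.
\<close>

definition undirected_tree :: "'a pair_pre_digraph \<Rightarrow> bool" where
  "undirected_tree T \<longleftrightarrow>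
     pair_graph T \<and> connected T \<and> \<not> (\<exists>p. pre_digraph.cycle T p \<and> length p \<ge> 3)"

definition undirected_spanning_tree :: "'a pair_pre_digraph \<Rightarrow> 'a pair_pre_digraph \<Rightarrow> bool" where
  "undirected_spanning_tree T G \<longleftrightarrow> undirected_tree T \<and> spanning T G"

definition tree_path :: "'a pair_pre_digraph \<Rightarrow> 'a \<Rightarrow> 'a \<Rightarrow> 'a set" where
  "tree_path T u v = set (pre_digraph.awalk_verts T u (THE p. pre_digraph.apath T u p v))"

text \<open>
  The trees form a list, so that pairs of trees are pairs of distinct indices.
\<close>

definition completely_independent_spanning_trees ::
    "'a pair_pre_digraph \<Rightarrow> 'a pair_pre_digraph list \<Rightarrow> bool" where
  "completely_independent_spanning_trees G Ts \<longleftrightarrow>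
     (\<forall>T \<in> set Ts. undirected_spanning_tree T G) \<and>
     (\<forall>i < length Ts. \<forall>j < length Ts. i \<noteq> j \<longrightarrow>
        parcs (Ts ! i) \<inter> parcs (Ts ! j) = {} \<and>
        (\<forall>u \<in> pverts G. \<forall>v \<in> pverts G.
           tree_path (Ts ! i) u v \<inter> tree_path (Ts ! j) u v = {u, v}))"

text \<open>
  The distance is the library's shortest-path cost for unit arc weights.
\<close>

definition graph_diameter :: "'a pair_pre_digraph \<Rightarrow> ereal" where
  "graph_diameter G = Max {wf_digraph.\<mu> G (\<lambda>_. 1) u v | u v. u \<in> pverts G \<and> v \<in> pverts G}"

end

theory Submission
  imports Defs
begin

text \<open>
  All three trees can be rooted with depth at most \<open>n\<close>, so even diameter \<open>2 * n\<close> is possible.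
  It suffices to colour the vertices such that all inner vertices of the \<open>i\<close>-th tree have colour
  \<open>i\<close>: the inner vertices of a path in a tree are inner vertices of the tree, so paths in different
  trees meet only in their ends. Such a family on \<open>Q\<^sub>n\<close> extends to \<open>Q\<^sub>n\<^sub>+\<^sub>1\<close> with the depth increased
  by one, which leaves the case \<open>n = 7\<close>, an explicit family.
\<close>

section \<open>Trees given by a parent map\<close>

lemma length_rev_path: "length (rev_path a) = length a"
  by (induction a) auto

definition parent_graph :: "'a set \<Rightarrow> ('a \<Rightarrow> 'a) \<Rightarrow> 'a pair_pre_digraph" where
  "parent_graph V p =
    \<lparr> pverts = V, parcs = {(x, y). x \<in> V \<and> y \<in> V \<and> x \<noteq> y \<and> (p x = y \<or> p y = x)} \<rparr>"

text \<open>Since \<open>p\<close> fixes \<open>r\<close>, the single exponent \<open>h\<close>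
  expresses that every vertex reaches the root within \<open>h\<close> steps.\<close>

locale parent_tree =
  fixes V :: "'a set" and p :: "'a \<Rightarrow> 'a" and r :: 'a and h :: nat
  assumes finite_V: "finite V"
    and root_in_V: "r \<in> V"
    and parent_root: "p r = r"
    and parent_in_V: "x \<in> V \<Longrightarrow> p x \<in> V"
    and reaches_root: "x \<in> V \<Longrightarrow> (p ^^ h) x = r"
begin

abbreviation T :: "'a pair_pre_digraph" where
  "T \<equiv> parent_graph V p"

lemma pverts_T [simp]: "pverts T = V"
  by (simp add: parent_graph_def)

lemma parcs_T: "(x, y) \<in> parcs T \<longleftrightarrow> x \<in> V \<and> y \<in> V \<and> x \<noteq> y \<and> (p x = y \<or> p y = x)"
  by (simp add: parent_graph_def)

sublocale pair_graph T
proof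
  show "finite (parcs T)"
    by (rule finite_subset[of _ "V \<times> V"]) (auto simp: parent_graph_def finite_V)
  show "symmetric T"
    by (auto simp: symmetric_def parent_graph_def intro: symI)
qed (auto simp: parent_graph_def finite_V)

section \<open>Depth, walks through the root and the diameter bound\<close>

definition depth :: "'a \<Rightarrow> nat" where
  "depth x = (LEAST k. (p ^^ k) x = r)"

lemma depth_le: "x \<in> V \<Longrightarrow> depth x \<le> h"
  unfolding depth_def by (rule Least_le) (rule reaches_root)

lemma depth_parent:
  assumes "x \<in> V" "x \<noteq> r"
  shows "depth x = Suc (depth (p x))"
proof -
  have "depth x = Suc (LEAST k. (p ^^ Suc k) x = r)"
    unfolding depth_def by (rule Least_Suc) (use assms reaches_root in auto)
  then show ?thesis
    by (simp add: depth_def funpow_Suc_right del: funpow.simps)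
qed

lemma parent_neq: "x \<in> V \<Longrightarrow> x \<noteq> r \<Longrightarrow> p x \<noteq> x"
  using depth_parent by fastforce

lemma awalk_to_root: "x \<in> V \<Longrightarrow> \<exists>a. awalk x a r \<and> length a = depth x"
proof (induction "depth x" arbitrary: x)
  case 0
  then have "x = r"
    using depth_parent by force
  then show ?case
    using 0 by (auto simp: awalk_Nil_iff)
next
  case (Suc k)
  then have "x \<noteq> r"
    by (auto simp: depth_def)
  with Suc.prems have "depth x = Suc (depth (p x))"
    by (simp add: depth_parent)
  with Suc obtain a where "awalk (p x) a r" "length a = depth (p x)"
    using parent_in_V by (metis Suc_inject)
  moreover have "(x, p x) \<in> parcs T"
    using Suc.prems \<open>x \<noteq> r\<close> parent_neq[of x] by (simp add: parcs_T parent_in_V)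
  ultimately have "awalk x ((x, p x) # a) r" "length ((x, p x) # a) = depth x"
    using \<open>depth x = Suc (depth (p x))\<close> by (simp_all add: awalk_Cons_iff)
  then show ?case by blast
qed

lemma awalk_length_le:
  assumes "u \<in> V" "v \<in> V"
  shows "\<exists>a. awalk u a v \<and> length a \<le> 2 * h"
proof -
  obtain a b where a: "awalk u a r" "length a = depth u" and b: "awalk v b r" "length b = depth v"
    using awalk_to_root assms by blast
  then have "awalk u (a @ rev_path b) v"
    by (auto intro: awalk_appendI)
  moreover have "length (a @ rev_path b) \<le> 2 * h"
    using a b depth_le[OF assms(1)] depth_le[OF assms(2)] by (simp add: length_rev_path)
  ultimately show ?thesis by blast
qed

lemma reachable_T: "u \<in> V \<Longrightarrow> v \<in> V \<Longrightarrow> u \<rightarrow>\<^sup>*\<^bsub>T\<^esub> v"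
  using awalk_length_le reachable_awalk by blast

lemma connected_T: "connected T"
  using root_in_V by (auto intro!: connectedI reachable_mk_symmetricI reachable_T)

lemma graph_diameter_T: "graph_diameter T \<le> ereal (real (2 * h))"
proof -
  have "\<mu> (\<lambda>_. 1) u v \<le> ereal (real (2 * h))" if uv: "u \<in> V" "v \<in> V" for u v
  proof -
    obtain a where a: "awalk u a v" "length a \<le> 2 * h"
      using awalk_length_le[OF uv] by blast
    have "\<mu> (\<lambda>_. 1) u v \<le> ereal (awalk_cost (\<lambda>_. 1) a)"
      using a(1) by (rule min_cost_le_walk_cost)
    also have "awalk_cost (\<lambda>_. 1) a = real (length a)"
      by (simp add: awalk_cost_def sum_list_triv)
    also have "ereal (real (length a)) \<le> ereal (real (2 * h))"
      using a(2) by (simp del: of_nat_mult)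
    finally show ?thesis .
  qed
  moreover have "finite {\<mu> (\<lambda>_. 1) u v | u v. u \<in> V \<and> v \<in> V}"
    using finite_V by (auto intro: finite_image_set2)
  ultimately show ?thesis
    using root_in_V unfolding graph_diameter_def by (intro Max.boundedI) (auto simp del: of_nat_mult)
qed

text \<open>
  A path that leaves \<open>u\<close> away from the root can never turn back, because its turning vertex
  would be entered and left through its parent.
\<close>

lemma depth_le_if_avoids_parent:
  assumes "apath u a v" "u \<noteq> r" "p u \<notin> set (awalk_verts u a)"
  shows "depth u \<le> depth v"
  using assms
proof (induction a arbitrary: u)
  case Nil
  then show ?case by (simp add: apath_Nil_iff)
next
  case (Cons e a)
  obtain y where e: "e = (u, y)"
    using Cons.prems(1) by (cases e) (simp add: apath_Cons_iff)
  have y: "(u, y) \<in> parcs T" "u \<notin> set (awalk_verts y a)" "apath y a v"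
    using Cons.prems(1) by (auto simp: apath_Cons_iff e)
  then have "y \<in> set (awalk_verts y a)"
    by (auto intro: hd_in_awalk_verts dest: awalkI_apath)
  then have "p u \<noteq> y"
    using Cons.prems(3) e by auto
  then have "p y = u" "y \<in> V"
    using y(1) by (auto simp: parcs_T)
  moreover from this have "y \<noteq> r"
    using Cons.prems(2) parent_root by auto
  ultimately show ?case
    using Cons.IH[OF y(3)] y(2) depth_parent[of y] by simp
qed

text \<open>A first step to a vertex \<open>y\<close> other than the parent would go to a child of
  \<open>u\<close>; the path then never returns to \<open>u\<close>, so
  \<open>depth u < depth y \<le> depth v\<close>, a contradiction.\<close>

lemma apath_first_step:
  assumes "apath u a v" "u \<noteq> v" "depth v \<le> depth u"
  obtains b where "a = (u, p u) # b" "apath (p u) b v" "u \<in> V" "u \<noteq> r"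
proof -
  obtain y b where a: "a = (u, y) # b"
    using assms(1,2) by (cases a) (auto simp: apath_simps)
  then have y: "(u, y) \<in> parcs T" "u \<notin> set (awalk_verts y b)" "apath y b v"
    using assms(1) by (auto simp: apath_Cons_iff)
  have "p u = y"
  proof (rule ccontr)
    assume "p u \<noteq> y"
    then have "p y = u" "y \<in> V" "u \<noteq> y"
      using y(1) by (auto simp: parcs_T)
    moreover from this have "y \<noteq> r"
      using parent_root by auto
    ultimately show False
      using depth_le_if_avoids_parent[OF y(3)] y(2) depth_parent[of y] assms(3) by simp
  qed
  moreover have "u \<in> V" "u \<noteq> r"
    using y(1) \<open>p u = y\<close> parent_root by (auto simp: parcs_T)
  ultimately show ?thesis
    using that a y(3) by blast
qed

text \<open>Induction on the sum of the depths of the ends: at the deeper end both paths must step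
  to its parent.\<close>

lemma apath_unique:
  assumes "apath u a v" "apath u b v"
  shows "a = b"
  using assms
proof (induction "depth u + depth v" arbitrary: u v a b rule: less_induct)
  case less
  \<comment> \<open>Fixing only the sum of the depths lets this serve for the reversed paths as
    well, when \<open>v\<close> is the deeper end.\<close>
  have *: "a' = b'"
    if asm: "apath u' a' v'" "apath u' b' v'" "depth u' + depth v' = depth u + depth v"
      "u' \<noteq> v'" "depth v' \<le> depth u'" for u' v' a' b'
  proof -
    obtain a2 where a2: "a' = (u', p u') # a2" "apath (p u') a2 v'" "u' \<in> V" "u' \<noteq> r"
      using apath_first_step[OF asm(1,4,5)] .
    obtain b2 where b2: "b' = (u', p u') # b2" "apath (p u') b2 v'"
      using apath_first_step[OF asm(2,4,5)] .
    have "depth (p u') + depth v' < depth u + depth v"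
      using asm(3) depth_parent[OF a2(3,4)] by simp
    with less.hyps a2 b2 show ?thesis by blast
  qed
  show ?case
  proof (cases "u = v")
    case True
    then show ?thesis
      using less.prems by (metis apath_nonempty_ends)
  next
    case False
    show ?thesis
    proof (cases "depth v \<le> depth u")
      case True
      with * False less.prems show ?thesis by blast
    next
      case False
      then have "rev_path a = rev_path b"
        using *[of v "rev_path a" u "rev_path b"] less.prems \<open>u \<noteq> v\<close> by simp
      then show ?thesis by (simp add: rev_path_eq)
    qed
  qed
qed

text \<open>Without its first arc a cycle is a path joining the ends of that arc, so by uniqueness
  it is the reversed arc alone.\<close>

lemma no_long_cycle: "\<not> (\<exists>a. cycle a \<and> length a \<ge> 3)"
proof safe
  fix a
  assume "cycle a" "length a \<ge> 3"
  then obtain u where a: "awalk u a u" "distinct (tl (awalk_verts u a))"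
    by (auto simp: cycle_def)
  obtain w b where b: "a = (u, w) # b"
    using a(1) \<open>length a \<ge> 3\<close> by (cases a) (auto simp: awalk_Cons_iff)
  then have "apath w b u" "(u, w) \<in> parcs T"
    using a by (auto simp: apath_def awalk_Cons_iff)
  moreover have "apath w [(w, u)] u"
    using \<open>(u, w) \<in> parcs T\<close> by (auto simp: apath_simps parcs_T)
  ultimately have "b = [(w, u)]"
    by (blast intro: apath_unique)
  then show False
    using b \<open>length a \<ge> 3\<close> by simp
qed

lemma undirected_tree_T: "undirected_tree T"
  using connected_T no_long_cycle pair_graph by (simp add: undirected_tree_def)

text \<open>An inner vertex has two different neighbours on the path; at most one is its parent, so
  another one is its child.\<close>

lemma apath_inner_verts:
  assumes "apath u a v" "w \<in> set (awalk_verts u a)" "w \<noteq> u" "w \<noteq> v"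
  shows "w \<in> p ` V"
  using assms
proof (induction a arbitrary: u)
  case Nil
  then show ?case by simp
next
  case (Cons e a)
  obtain y where e: "e = (u, y)"
    using Cons.prems(1) by (cases e) (simp add: apath_Cons_iff)
  have y: "(u, y) \<in> parcs T" "u \<notin> set (awalk_verts y a)" "apath y a v"
    using Cons.prems(1) by (auto simp: apath_Cons_iff e)
  show ?case
  proof (cases "w = y")
    case False
    then show ?thesis
      using Cons.IH[OF y(3)] Cons.prems e by auto
  next
    case True
    then obtain z b where z: "a = (w, z) # b"
      using y(3) Cons.prems(4) by (cases a) (auto simp: apath_simps)
    then have "(w, z) \<in> parcs T" "z \<noteq> u"
      using y True by (auto simp: apath_Cons_iff dest!: awalkI_apath hd_in_awalk_verts)
    then show ?thesis
      using y(1) True by (auto simp: parcs_T)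
  qed
qed

section \<open>Vertex sets of tree paths\<close>

lemma tree_pathE:
  assumes "u \<in> V" "v \<in> V"
  obtains a where "apath u a v" "tree_path T u v = set (awalk_verts u a)"
proof -
  obtain a where a: "apath u a v"
    using reachable_T[OF assms] by (auto simp: reachable_apath)
  then have "(THE a. apath u a v) = a"
    by (blast intro: apath_unique)
  with a that show ?thesis
    by (auto simp: tree_path_def)
qed

lemma tree_path_subset:
  assumes "u \<in> V" "v \<in> V"
  shows "tree_path T u v \<subseteq> {u, v} \<union> p ` V"
proof -
  obtain a where "apath u a v" "tree_path T u v = set (awalk_verts u a)"
    using tree_pathE[OF assms] .
  then show ?thesis
    using apath_inner_verts by blast
qed

lemma tree_path_ends:
  assumes "u \<in> V" "v \<in> V"
  shows "{u, v} \<subseteq> tree_path T u v"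
proof -
  obtain a where a: "apath u a v" "tree_path T u v = set (awalk_verts u a)"
    using tree_pathE[OF assms] .
  then have "hd (awalk_verts u a) = u" "last (awalk_verts u a) = v"
    by (auto simp: apath_def)
  then show ?thesis
    using a(2) hd_in_set[of "awalk_verts u a"] last_in_set[of "awalk_verts u a"] by simp
qed

end

section \<open>Families of parent maps on the hypercube\<close>

abbreviation cube_verts :: "nat \<Rightarrow> bool list set" where
  "cube_verts n \<equiv> {x. length x = n}"

section \<open>Arcs of the hypercube\<close>

lemma finite_cube_verts: "finite (cube_verts n)"
  using finite_lists_length_eq[of "UNIV :: bool set" n] by simp

lemma pverts_hypercube [simp]: "pverts (hypercube n) = cube_verts n"
  by (simp add: hypercube_def)

lemma hypercube_arc_length:
  "(x, y) \<in> parcs (hypercube n) \<Longrightarrow> length x = n"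
  "(x, y) \<in> parcs (hypercube n) \<Longrightarrow> length y = n"
  by (auto simp: hypercube_def)

lemma hypercube_arc_commute: "(x, y) \<in> parcs (hypercube n) \<Longrightarrow> (y, x) \<in> parcs (hypercube n)"
proof -
  have "x ! i = (\<not> y ! i) \<longleftrightarrow> y ! i = (\<not> x ! i)" for i
    by auto
  then show "(x, y) \<in> parcs (hypercube n) \<Longrightarrow> (y, x) \<in> parcs (hypercube n)"
    by (simp add: hypercube_def)
qed

lemma wf_digraph_hypercube: "wf_digraph (hypercube n)"
  by unfold_locales (auto simp: hypercube_def)

lemma hypercube_arc_flip:
  assumes "k < length x"
  shows "(x, x[k := \<not> x ! k]) \<in> parcs (hypercube (length x))"
  using assms by (auto simp: hypercube_def nth_list_update intro!: ex1I[of _ k] split: if_splits)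

lemma Ex1_case_nat: "(\<exists>!i. case i of 0 \<Rightarrow> A | Suc k \<Rightarrow> P k) \<longleftrightarrow> (if A then \<forall>k. \<not> P k else \<exists>!k. P k)"
proof (cases A)
  case True
  then have "(\<exists>!i. case i of 0 \<Rightarrow> A | Suc k \<Rightarrow> P k) \<longleftrightarrow> (\<forall>i. (case i of 0 \<Rightarrow> A | Suc k \<Rightarrow> P k) \<longrightarrow> i = 0)"
    by (metis nat.case(1))
  then show ?thesis
    using True by (auto dest: spec[of _ "Suc _"] split: nat.split)
next
  case False
  then have *: "(case i of 0 \<Rightarrow> A | Suc k \<Rightarrow> P k) \<longleftrightarrow> (\<exists>k. i = Suc k \<and> P k)" for i
    by (cases i) auto
  show ?thesis
    unfolding * using False by auto
qed

lemma hypercube_arc_Cons: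
  assumes "length x = n" "length y = n"
  shows "(a # x, b # y) \<in> parcs (hypercube (Suc n)) \<longleftrightarrow>
    (if a = b then (x, y) \<in> parcs (hypercube n) else x = y)"
proof -
  have "(\<lambda>i. i < Suc n \<and> (a # x) ! i \<noteq> (b # y) ! i) =
      case_nat (a \<noteq> b) (\<lambda>k. k < n \<and> x ! k \<noteq> y ! k)"
    by (auto simp: fun_eq_iff split: nat.split)
  then have "(\<exists>!i. i < Suc n \<and> (a # x) ! i \<noteq> (b # y) ! i) \<longleftrightarrow>
      (if a = b then \<exists>!k. k < n \<and> x ! k \<noteq> y ! k else \<forall>k<n. x ! k = y ! k)"
    by (simp add: Ex1_case_nat)
  then show ?thesis
    using assms by (simp add: hypercube_def list_eq_iff_nth_eq)
qed

text \<open>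
  The colour class \<open>i\<close> contains all inner vertices of the tree with parent map \<open>p i\<close>.
  Hence two trees can only share an edge that they orient in opposite directions, which the last
  condition excludes.
\<close>

definition cist_family ::
    "nat \<Rightarrow> nat \<Rightarrow> nat \<Rightarrow> (bool list \<Rightarrow> nat) \<Rightarrow> (nat \<Rightarrow> bool list \<Rightarrow> bool list) \<Rightarrow> (nat \<Rightarrow> bool list) \<Rightarrow> bool"
  where
  "cist_family m n h c p r \<longleftrightarrow>
     (\<forall>i < m. length (r i) = n \<and> p i (r i) = r i \<and>
        (\<forall>x. length x = n \<longrightarrow>
           (x = r i \<or> (x, p i x) \<in> parcs (hypercube n)) \<and> c (p i x) = i \<and> (p i ^^ h) x = r i \<and>
           (\<forall>j < m. j \<noteq> i \<longrightarrow> p j (p i x) \<noteq> x)))"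

lemma cist_familyD:
  assumes "cist_family m n h c p r" "i < m"
  shows "length (r i) = n" "p i (r i) = r i"
    and "length x = n \<Longrightarrow> x = r i \<or> (x, p i x) \<in> parcs (hypercube n)"
    and "length x = n \<Longrightarrow> c (p i x) = i"
    and "length x = n \<Longrightarrow> (p i ^^ h) x = r i"
    and "length x = n \<Longrightarrow> j < m \<Longrightarrow> i \<noteq> j \<Longrightarrow> p j (p i x) \<noteq> x"
  using assms by (auto simp: cist_family_def)

section \<open>From a family to completely independent spanning trees\<close>

lemma cist_family_imp_parent_tree:
  assumes "cist_family m n h c p r" "i < m"
  shows "parent_tree (cube_verts n) (p i) (r i) h"
proof
  note D = cist_familyD[OF assms]
  show "p i x \<in> cube_verts n" if "x \<in> cube_verts n" for x
    using that D(1,2) D(3)[of x] by (auto dest: hypercube_arc_length(2))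
  show "finite (cube_verts n)" "r i \<in> cube_verts n" "p i (r i) = r i"
    using D(1,2) finite_cube_verts by auto
  show "(p i ^^ h) x = r i" if "x \<in> cube_verts n" for x
    using that D(5) by simp
qed

lemma cist_family_trees:
  assumes "cist_family m n h c p r"
  defines "Ts \<equiv> map (\<lambda>i. parent_graph (cube_verts n) (p i)) [0..<m]"
  shows "completely_independent_spanning_trees (hypercube n) Ts"
    and "T \<in> set Ts \<Longrightarrow> graph_diameter T \<le> ereal (real (2 * h))"
proof -
  let ?T = "\<lambda>i. parent_graph (cube_verts n) (p i)"
  note tree = cist_family_imp_parent_tree[OF assms(1)]
  note colour = cist_familyD(4)[OF assms(1)]
  note no_swap = cist_familyD(6)[OF assms(1)]
  have spanning: "undirected_spanning_tree (?T i) (hypercube n)" if "i < m" for i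
  proof -
    interpret parent_tree "cube_verts n" "p i" "r i" h
      using tree[OF that] .
    have "(x, y) \<in> parcs (hypercube n)" if "(x, y) \<in> parcs (?T i)" for x y
    proof -
      have "(x, p i x) \<in> parcs (hypercube n)" if "length x = n" "p i x \<noteq> x" for x
        using cist_familyD(2,3)[OF assms(1) \<open>i < m\<close>] that by metis
      then show ?thesis
        using that by (auto simp: parcs_T intro: hypercube_arc_commute)
    qed
    then have "subgraph (?T i) (hypercube n)"
      using wf_digraph_hypercube wf_digraph by (auto simp: subgraph_def compatible_def)
    then show ?thesis
      using undirected_tree_T by (simp add: undirected_spanning_tree_def spanning_def)
  qed
  have arcs_disjoint: "parcs (?T i) \<inter> parcs (?T j) = {}" if "i < m" "j < m" "i \<noteq> j" for i j
  proof -
    \<comment> \<open>If both trees orient the edge alike, the common parent has colours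
      \<open>i\<close> and \<open>j\<close>; opposite orientations contradict
      \<open>no_swap\<close>.\<close>
    have "False" if "(x, y) \<in> parcs (?T i)" "(x, y) \<in> parcs (?T j)" for x y
      using that \<open>i < m\<close> \<open>j < m\<close> \<open>i \<noteq> j\<close> colour no_swap
      by (simp add: parent_graph_def) metis
    then show ?thesis by auto
  qed
  have paths: "tree_path (?T i) u v \<inter> tree_path (?T j) u v = {u, v}"
    if "i < m" "j < m" "i \<noteq> j" "length u = n" "length v = n" for i j u v
  proof -
    have disj: "p i ` cube_verts n \<inter> p j ` cube_verts n = {}"
      using colour[OF \<open>i < m\<close>] colour[OF \<open>j < m\<close>] \<open>i \<noteq> j\<close> by fastforce
    have "tree_path (?T k) u v \<subseteq> {u, v} \<union> p k ` cube_verts n \<and> {u, v} \<subseteq> tree_path (?T k) u v"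
      if "k < m" for k
      using parent_tree.tree_path_subset[OF tree[OF that], of u v]
        parent_tree.tree_path_ends[OF tree[OF that], of u v] \<open>length u = n\<close> \<open>length v = n\<close> by simp
    from this[OF \<open>i < m\<close>] this[OF \<open>j < m\<close>] disj show ?thesis
      by (simp add: set_eq_iff subset_iff disjoint_iff) metis
  qed
  show "completely_independent_spanning_trees (hypercube n) Ts"
    unfolding completely_independent_spanning_trees_def Ts_def
    by (simp add: spanning arcs_disjoint paths)
  show "graph_diameter T \<le> ereal (real (2 * h))" if "T \<in> set Ts"
    using that parent_tree.graph_diameter_T[OF tree] by (auto simp: Ts_def simp del: of_nat_mult)
qed

text \<open>
  In the upper copy of the cube, every vertex of class \<open>i\<close> hangs below its twin in the lower copy,
  so the \<open>i\<close>-th tree uses only those edges between the copies that join vertices of class \<open>i\<close>;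
  the leaves of the upper copy keep their parents.
\<close>

definition extend_parent :: "(bool list \<Rightarrow> bool) \<Rightarrow> (bool list \<Rightarrow> bool list) \<Rightarrow> bool list \<Rightarrow> bool list" where
  "extend_parent I q y =
    (if hd y then if I (tl y) then False # tl y else True # q (tl y) else False # q (tl y))"

lemma extend_parent_simps [simp]:
  "extend_parent I q (False # x) = False # q x"
  "I x \<Longrightarrow> extend_parent I q (True # x) = False # x"
  "\<not> I x \<Longrightarrow> extend_parent I q (True # x) = True # q x"
  by (simp_all add: extend_parent_def)

lemma funpow_extend_parent_False: "(extend_parent I q ^^ k) (False # x) = False # (q ^^ k) x"
  by (induction k) auto

text \<open>Starting in the upper copy, one of the first two steps goes down: the first if
  \<open>x\<close> is in the class, otherwise the second, because \<open>q x\<close> is. All other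
  steps apply \<open>q\<close>.\<close>

lemma funpow_extend_parent:
  assumes "I (q x)"
  shows "(extend_parent I q ^^ Suc (Suc k)) (b # x) =
    False # (q ^^ (if b then Suc k else Suc (Suc k))) x"
  using assms
  by (cases b; cases "I x") (simp_all add: funpow_Suc_right funpow_extend_parent_False del: funpow.simps)

lemma cist_family_Suc:
  assumes "cist_family m n h c p r" "h > 0"
  shows "cist_family m (Suc n) (Suc h) (c \<circ> tl) (\<lambda>i. extend_parent (\<lambda>x. c x = i) (p i))
    (\<lambda>i. False # r i)"
  unfolding cist_family_def
proof (intro allI impI conjI)
  fix i
  assume i: "i < m"
  let ?p = "\<lambda>i. extend_parent (\<lambda>x. c x = i) (p i)"
  interpret parent_tree "cube_verts n" "p i" "r i" h
    using cist_family_imp_parent_tree[OF assms(1) i] .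
  show "length (False # r i) = Suc n" "?p i (False # r i) = False # r i"
    using root_in_V parent_root by simp_all
  fix y :: "bool list"
  assume "length y = Suc n"
  then obtain b x where y: "y = b # x" and x: "length x = n"
    by (cases y) auto
  have arc: "x = r i \<or> (x, p i x) \<in> parcs (hypercube n)" and colour: "c (p i x) = i"
    and no_swap: "\<And>j. j < m \<Longrightarrow> j \<noteq> i \<Longrightarrow> p j (p i x) \<noteq> x"
    using cist_familyD(3,4,6)[OF assms(1) i x] by auto
  have px: "length (p i x) = n"
    using parent_in_V x by simp
  \<comment> \<open>Hence the upper twin of the root hangs below the root and is not a second fixed
    point.\<close>
  have "c (r i) = i"
    using cist_familyD(1,2,4)[OF assms(1) i] by metis
  then show "y = False # r i \<or> (y, ?p i y) \<in> parcs (hypercube (Suc n))"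
    using arc x px by (cases b; cases "c x = i") (auto simp: y hypercube_arc_Cons)
  show "(c \<circ> tl) (?p i y) = i"
    using colour by (cases b; cases "c x = i") (auto simp: y)
  \<comment> \<open>Now \<open>Suc h\<close> has the form \<open>Suc (Suc k)\<close>. From the upper
    copy \<open>h\<close> steps of \<open>p i\<close> remain; from the lower copy there is one more,
    which stays at the root.\<close>
  obtain k where k: "h = Suc k"
    using assms(2) by (cases h) auto
  show "(?p i ^^ Suc h) y = False # r i"
    using colour reaches_root[of x] parent_root x
    unfolding y k by (subst funpow_extend_parent) simp_all
  fix j
  assume j: "j < m" "j \<noteq> i"
  \<comment> \<open>Edges between the copies are only ever oriented downwards. If tree
    \<open>i\<close> stays in the upper copy, its parent there has colour \<open>i\<close>, so tree
    \<open>j\<close> stays there too and the old condition applies.\<close>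
  show "?p j (?p i y) \<noteq> y"
    using no_swap[OF j] colour j by (cases b; cases "c x = i") (auto simp: y)
qed

section \<open>Three trees on the 7-dimensional cube\<close>

datatype 'a trie = Leaf 'a | Branch "'a trie" "'a trie"

fun lookup :: "'a trie \<Rightarrow> bool list \<Rightarrow> 'a" where
  "lookup (Branch s t) (b # x) = lookup (if b then t else s) x"
| "lookup (Leaf a) _ = a"
| "lookup _ [] = undefined"

fun pair_up :: "'a trie list \<Rightarrow> 'a trie list" where
  "pair_up (s # t # ts) = Branch s t # pair_up ts"
| "pair_up ts = ts"

text \<open>With \<open>2 ^ n\<close> entries, \<open>n\<close> rounds of pairing leave one trie.
  The last round creates the top branch, so the first coordinate is the most significant bit of the
  position.\<close>

definition trie_of_list :: "nat \<Rightarrow> 'a list \<Rightarrow> 'a trie" where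
  "trie_of_list n xs = hd ((pair_up ^^ n) (map Leaf xs))"

text \<open>
  A parent is encoded by the coordinate to flip; the root has the out-of-range coordinate \<open>n\<close>, for
  which the list update does nothing.
\<close>

definition flip_parent :: "nat trie list \<Rightarrow> nat \<Rightarrow> bool list \<Rightarrow> bool list" where
  "flip_parent fs i x = (let k = lookup (fs ! i) x in x[k := \<not> x ! k])"

text \<open>
  The checker applies named functions instead of abstractions and iterates by \<open>climb\<close> instead of
  \<open>(^^)\<close>, because symbolic evaluation under a binder duplicates the argument at each step.
\<close>

fun climb :: "nat \<Rightarrow> ('a \<Rightarrow> 'a) \<Rightarrow> 'a \<Rightarrow> 'a" where
  "climb 0 f x = x"
| "climb (Suc k) f x = climb k f (f x)"

lemma climb_eq_funpow: "climb k f x = (f ^^ k) x"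
  by (induction k arbitrary: x) (simp_all add: funpow_swap1)

definition no_swap :: "nat trie list \<Rightarrow> nat \<Rightarrow> bool list \<Rightarrow> nat \<Rightarrow> bool" where
  "no_swap fs i x j \<longleftrightarrow> j = i \<or> flip_parent fs j (flip_parent fs i x) \<noteq> x"

text \<open>A flipped coordinate below \<open>n\<close> already guarantees an arc, which spares
  evaluating adjacency in the cube.\<close>

definition valid_vertex ::
    "nat \<Rightarrow> nat trie \<Rightarrow> nat trie list \<Rightarrow> bool list list \<Rightarrow> nat \<Rightarrow> bool list \<Rightarrow> bool" where
  "valid_vertex n c fs rs i x \<longleftrightarrow>
     (lookup (fs ! i) x < n \<or> x = rs ! i) \<and>
     lookup c (flip_parent fs i x) = i \<and>
     climb n (flip_parent fs i) x = rs ! i \<and>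
     list_all (no_swap fs i x) [0..<length fs]"

definition valid_tree :: "nat \<Rightarrow> nat trie \<Rightarrow> nat trie list \<Rightarrow> bool list list \<Rightarrow> nat \<Rightarrow> bool" where
  "valid_tree n c fs rs i \<longleftrightarrow>
     length (rs ! i) = n \<and> flip_parent fs i (rs ! i) = rs ! i \<and>
     list_all (valid_vertex n c fs rs i) (List.n_lists n [False, True])"

lemma valid_tree_imp_cist_family:
  assumes "list_all (valid_tree n c fs rs) [0..<length fs]"
  shows "cist_family (length fs) n n (lookup c) (flip_parent fs) (\<lambda>i. rs ! i)"
  unfolding cist_family_def
proof (intro allI impI)
  fix i
  assume "i < length fs"
  then have tree: "valid_tree n c fs rs i"
    using assms by (simp add: list_all_iff)
  have "set (List.n_lists n [False, True]) = cube_verts n"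
    by (auto simp: set_n_lists)
  then have vertex: "valid_vertex n c fs rs i x" if "length x = n" for x
    using tree that by (simp add: valid_tree_def list_all_iff)
  have arc: "(x, flip_parent fs i x) \<in> parcs (hypercube n)"
    if "length x = n" "lookup (fs ! i) x < n" for x
    using hypercube_arc_flip[of "lookup (fs ! i) x" x] that by (simp add: flip_parent_def Let_def)
  have "(x = rs ! i \<or> (x, flip_parent fs i x) \<in> parcs (hypercube n)) \<and>
      lookup c (flip_parent fs i x) = i \<and> (flip_parent fs i ^^ n) x = rs ! i \<and>
      (\<forall>j < length fs. j \<noteq> i \<longrightarrow> flip_parent fs j (flip_parent fs i x) \<noteq> x)"
    if "length x = n" for x
    using vertex[OF that] arc[OF that]
    by (auto simp: valid_vertex_def no_swap_def climb_eq_funpow list_all_iff)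
  then show "length (rs ! i) = n \<and> flip_parent fs i (rs ! i) = rs ! i \<and>
      (\<forall>x. length x = n \<longrightarrow> (x = rs ! i \<or> (x, flip_parent fs i x) \<in> parcs (hypercube n)) \<and>
        lookup c (flip_parent fs i x) = i \<and> (flip_parent fs i ^^ n) x = rs ! i \<and>
        (\<forall>j < length fs. j \<noteq> i \<longrightarrow> flip_parent fs j (flip_parent fs i x) \<noteq> x))"
    using tree by (simp add: valid_tree_def)
qed

text \<open>
  The classes were found by simulated annealing on 3-colourings of the vertices, such that class
  \<open>i\<close> induces a connected graph of radius at most 6 around the \<open>i\<close>-th root. The parents of the leaves
  come from a matching that assigns to every vertex its own edge towards each other class.
  Vertices are listed in lexicographic order.
\<close>

definition colours7 :: "nat trie" where
  "colours7 = trie_of_list 7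
    [0,2,1,0,2,1,2,2,0,0,0,2,1,0,0,0,0,0,1,0,2,1,0,2,0,1,2,1,0,1,0,1,
     0,2,1,1,0,2,1,2,2,1,2,1,1,1,2,0,2,1,1,0,2,2,1,2,1,2,2,2,1,1,1,0,
     0,1,0,2,2,1,0,1,1,0,0,2,1,2,0,2,1,2,1,2,1,0,1,1,2,0,0,0,2,2,0,1,
     1,1,1,0,0,1,1,2,2,1,2,1,0,2,2,2,1,1,2,0,0,0,2,2,1,0,0,2,1,1,2,2]"

definition flips7 :: "nat trie list" where
  "flips7 = map (trie_of_list 7)
   [[7,3,0,2,4,3,2,4,3,6,5,4,4,4,4,6,2,6,4,5,3,4,3,4,3,3,2,3,4,6,5,6,
     1,6,5,1,4,6,5,3,3,1,1,4,0,1,1,1,1,5,6,1,2,0,1,4,1,0,0,4,1,5,6,2,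
     0,6,5,0,5,2,4,6,3,0,3,6,1,4,4,0,0,0,2,1,6,1,2,5,0,2,2,6,5,3,4,4,
     1,5,6,2,0,6,5,4,4,1,2,3,3,6,1,0,4,3,6,0,2,6,5,4,6,1,1,1,3,3,4,0],
    [5,0,2,6,6,2,1,5,0,2,3,1,1,2,5,2,5,1,0,6,6,3,0,0,6,4,6,5,2,1,1,5,
     0,2,0,6,3,1,2,4,2,4,6,5,2,6,3,5,0,0,4,2,5,1,3,6,0,2,4,1,4,6,5,1,
     2,1,1,4,2,4,1,2,4,3,5,1,0,3,5,3,1,6,5,6,4,0,5,6,2,0,3,0,2,5,3,0,
     2,6,5,0,4,4,4,1,2,3,3,5,2,0,3,4,3,6,0,5,1,2,2,1,7,2,5,2,4,6,0,1],
    [6,1,4,3,5,4,6,1,1,5,6,0,3,0,3,3,4,2,3,0,2,5,5,2,5,1,1,2,0,0,4,3,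
     2,4,3,5,1,5,6,0,5,3,4,2,4,3,0,6,4,3,3,3,6,5,0,2,3,5,6,0,3,3,2,3,
     4,2,6,3,0,6,0,0,1,5,1,4,3,5,6,1,3,5,1,2,0,4,1,4,4,3,0,2,6,2,1,2,
     3,0,2,1,1,0,6,7,5,4,4,6,5,5,6,3,5,1,4,3,0,5,6,2,1,5,3,4,1,1,6,3]]"

text \<open>Positions 0, 120 and 103 in binary, where the three tables of \<open>flips7\<close> hold
  the out-of-range value 7.\<close>

definition roots7 :: "bool list list" where
  "roots7 =
    [[False, False, False, False, False, False, False],
     [True, True, True, True, False, False, False],
     [True, True, False, False, True, True, True]]"

lemma valid_trees7: "list_all (valid_tree 7 colours7 flips7 roots7) [0..<length flips7]"
  by code_simp

lemma cist_family_7: "\<exists>c p r. cist_family 3 7 7 c p r"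
proof -
  have "length flips7 = 3"
    by (simp add: flips7_def)
  then show ?thesis
    using valid_tree_imp_cist_family[OF valid_trees7] by metis
qed

section \<open>All dimensions from 7 on\<close>

lemma cist_family_exists:
  assumes "n \<ge> 7"
  shows "\<exists>c p r. cist_family 3 n n c p r"
  using assms
proof (induction n rule: dec_induct)
  case base
  then show ?case
    by (rule cist_family_7)
next
  case (step n)
  then show ?case
    using cist_family_Suc[of 3 n n] by fastforce
qed

theorem theorem6p1:
  fixes n :: nat
  assumes "n \<ge> 7"
  shows "\<exists>T1 T2 T3 :: bool list pair_pre_digraph.
    completely_independent_spanning_trees (hypercube n) [T1, T2, T3] \<and>
    graph_diameter T1 \<le> ereal (real (2 * n + 1)) \<and>
    graph_diameter T2 \<le> ereal (real (2 * n + 3)) \<and>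
    graph_diameter T3 \<le> ereal (real (2 * n + 4))"
proof -
  obtain c p r where family: "cist_family 3 n n c p r"
    using cist_family_exists[OF assms] by blast
  let ?T = "\<lambda>i. parent_graph (cube_verts n) (p i)"
  have trees: "map ?T [0..<3] = [?T 0, ?T 1, ?T 2]"
    by (simp add: upt_rec numeral_2_eq_2)
  \<comment> \<open>Depth at most \<open>n\<close> bounds every diameter by \<open>2 * n\<close>;
    the summand \<open>k\<close> is slack that covers the three required bounds.\<close>
  have diam: "graph_diameter (?T i) \<le> ereal (real (2 * n + k))" if "i < 3" for i k
  proof -
    have "graph_diameter (?T i) \<le> ereal (real (2 * n))"
      using that by (intro cist_family_trees(2)[OF family]) auto
    also have "\<dots> \<le> ereal (real (2 * n + k))"
      by simp
    finally show ?thesis .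
  qed
  have "completely_independent_spanning_trees (hypercube n) [?T 0, ?T 1, ?T 2]"
    using cist_family_trees(1)[OF family] unfolding trees .
  moreover have "graph_diameter (?T 0) \<le> ereal (real (2 * n + 1))"
    "graph_diameter (?T 1) \<le> ereal (real (2 * n + 3))"
    "graph_diameter (?T 2) \<le> ereal (real (2 * n + 4))"
    by (rule diam; simp)+
  ultimately show ?thesis
    by blast
qed

end
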